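(* Let $X$ be a homogeneous $T_3$ (regular Hausdorff) topological space. Then $|X|\leq \pi\chi(X)^{c(X)\,q\psi(X)}$.
   Context: A topological space $X$ is homogeneous if for all $x,y\in X$ there is a homeomorphism $h:X\to X$ with $h(x)=y$. A local $\pi$-base at a point $x\in X$ is a family $\mathcal{B}$ of nonempty open subsets of $X$ such that every open set containing $x$ contains some member of $\mathcal{B}$. The $\pi$-character $\pi\chi(x,X)$ is the least infinite cardinal $\kappa$ such that $x$ has a local $\pi$-base of cardinality at most $\kappa$, and $\pi\chi(X)=\sup\{\pi\chi(x,X):x\in X\}$. A cellular family is a family of pairwise disjoint nonempty open sets; the cellularity $c(X)$ is the least infinite cardinal $\kappa$ such that every cellular family in $X$ has cardinality at most $\kappa$. For a point $x\in X$, a family $\mathcal{B}$ of nonempty open subsets of $X$ is a $q$-pseudo base of $x$ in $X$ if for each $y\in X$ with $y\neq x$ there is a subfamily $\mathcal{C}\subseteq\mathcal{B}$ such that $x\in\overline{\bigcup\mathcal{C}}$ and $y\notin\overline{\bigcup\mathcal{C}}$. The $q$-pseudo character of $x$ in $X$ is $q\psi(x,X)=\min\{|\mathcal{B}|:\mathcal{B}\text{ is a }q\text{-pseudo base of }x\text{ in }X\}$, and $q\psi(X)=\sup\{q\psi(x,X):x\in X\}$. (In a Hausdorff space every point has a $q$-pseudo base.) *)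

theory Defs
  imports "HOL-Analysis.Analysis"
begin

unbundle cardinal_syntax
no_notation Set_Algebras.elt_set_eq (infix \<open>=o\<close> 50)

text \<open>
  Cardinals are represented by cardinal orders, which are unique only up to \<open>=o\<close>.
  The cardinal functions of a space with points of type \<open>'a\<close> take their values in
  orders over \<open>'a set + nat\<close>: this type is infinite and every family of subsets of
  \<open>'a\<close> embeds into it.  So it has room for each minimum and supremum below
  (the lemmas after the definitions confirm this), and an order that is least over this type
  is least among the cardinals over all types.
\<close>

type_synonym 'a cardinal = "('a set + nat) rel"

definition least_cardinal :: "('k rel \<Rightarrow> bool) \<Rightarrow> 'k rel" where
  "least_cardinal P =
    (SOME \<kappa>. Card_order \<kappa> \<and> P \<kappa> \<and> (\<forall>\<kappa>'. Card_order \<kappa>' \<and> P \<kappa>' \<longrightarrow> \<kappa> \<le>o \<kappa>'))"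

definition cardinal_Sup :: "'k rel set \<Rightarrow> 'k rel" where
  "cardinal_Sup K = least_cardinal (\<lambda>\<kappa>. \<forall>\<mu>\<in>K. \<mu> \<le>o \<kappa>)"

definition homogeneous_space :: "'a topology \<Rightarrow> bool" where
  "homogeneous_space X \<longleftrightarrow>
    (\<forall>x\<in>topspace X. \<forall>y\<in>topspace X. \<exists>h. homeomorphic_map X X h \<and> h x = y)"

definition open_family :: "'a topology \<Rightarrow> 'a set set \<Rightarrow> bool" where
  "open_family X \<B> \<longleftrightarrow> (\<forall>U\<in>\<B>. openin X U \<and> U \<noteq> {})"

definition local_pi_base :: "'a topology \<Rightarrow> 'a \<Rightarrow> 'a set set \<Rightarrow> bool" where
  "local_pi_base X x \<B> \<longleftrightarrow>
    open_family X \<B> \<and> (\<forall>U. openin X U \<and> x \<in> U \<longrightarrow> (\<exists>B\<in>\<B>. B \<subseteq> U))"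

definition pi_character_at :: "'a topology \<Rightarrow> 'a \<Rightarrow> 'a cardinal" where
  "pi_character_at X x =
    least_cardinal (\<lambda>\<kappa>. cinfinite \<kappa> \<and> (\<exists>\<B>. local_pi_base X x \<B> \<and> |\<B>| \<le>o \<kappa>))"

definition pi_character :: "'a topology \<Rightarrow> 'a cardinal" where
  "pi_character X = cardinal_Sup (pi_character_at X ` topspace X)"

definition cellular_family :: "'a topology \<Rightarrow> 'a set set \<Rightarrow> bool" where
  "cellular_family X \<U> \<longleftrightarrow> open_family X \<U> \<and> pairwise disjnt \<U>"

definition cellularity :: "'a topology \<Rightarrow> 'a cardinal" where
  "cellularity X =
    least_cardinal (\<lambda>\<kappa>. cinfinite \<kappa> \<and> (\<forall>\<U>. cellular_family X \<U> \<longrightarrow> |\<U>| \<le>o \<kappa>))"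

definition q_pseudo_base :: "'a topology \<Rightarrow> 'a \<Rightarrow> 'a set set \<Rightarrow> bool" where
  "q_pseudo_base X x \<B> \<longleftrightarrow>
    open_family X \<B> \<and>
    (\<forall>y\<in>topspace X. y \<noteq> x \<longrightarrow>
      (\<exists>\<C>\<subseteq>\<B>. x \<in> X closure_of \<Union>\<C> \<and> y \<notin> X closure_of \<Union>\<C>))"

definition q_pseudo_character_at :: "'a topology \<Rightarrow> 'a \<Rightarrow> 'a cardinal" where
  "q_pseudo_character_at X x = least_cardinal (\<lambda>\<kappa>. \<exists>\<B>. q_pseudo_base X x \<B> \<and> |\<B>| =o \<kappa>)"

definition q_pseudo_character :: "'a topology \<Rightarrow> 'a cardinal" where
  "q_pseudo_character X = cardinal_Sup (q_pseudo_character_at X ` topspace X)"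

lemma least_cardinal:
  assumes "Card_order \<kappa>" "P \<kappa>"
  shows "Card_order (least_cardinal P)" and "P (least_cardinal P)"
    and "\<And>\<kappa>'. Card_order \<kappa>' \<Longrightarrow> P \<kappa>' \<Longrightarrow> least_cardinal P \<le>o \<kappa>'"
proof -
  have "\<exists>\<kappa>\<in>{\<kappa>. Card_order \<kappa> \<and> P \<kappa>}. \<forall>\<kappa>'\<in>{\<kappa>. Card_order \<kappa> \<and> P \<kappa>}. \<kappa> \<le>o \<kappa>'"
    using assms by (intro exists_minim_Card_order) auto
  then have "\<exists>\<kappa>. Card_order \<kappa> \<and> P \<kappa> \<and> (\<forall>\<kappa>'. Card_order \<kappa>' \<and> P \<kappa>' \<longrightarrow> \<kappa> \<le>o \<kappa>')"
    by auto
  from someI_ex[OF this, folded least_cardinal_def]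
  show "Card_order (least_cardinal P)" "P (least_cardinal P)"
    "\<And>\<kappa>'. Card_order \<kappa>' \<Longrightarrow> P \<kappa>' \<Longrightarrow> least_cardinal P \<le>o \<kappa>'" by auto
qed

lemma family_le_UNIV: "|\<B> :: 'a set set| \<le>o |UNIV :: ('a set + nat) set|"
  by (rule card_of_ordLeqI[of Inl]) auto

lemma cinfinite_UNIV: "cinfinite |UNIV :: ('a set + nat) set|"
  unfolding cinfinite_def by (simp add: finite_Plus_UNIV_iff Field_card_of)

lemma cardinal_Sup:
  fixes K :: "'k rel set"
  assumes "\<And>\<mu>. \<mu> \<in> K \<Longrightarrow> Card_order \<mu>"
  shows "Card_order (cardinal_Sup K)" and "\<And>\<mu>. \<mu> \<in> K \<Longrightarrow> \<mu> \<le>o cardinal_Sup K"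
    and "\<And>\<kappa> :: 'k rel. Card_order \<kappa> \<Longrightarrow> (\<And>\<mu>. \<mu> \<in> K \<Longrightarrow> \<mu> \<le>o \<kappa>) \<Longrightarrow> cardinal_Sup K \<le>o \<kappa>"
proof -
  have "\<mu> \<le>o |UNIV :: 'k set|" if "\<mu> \<in> K" for \<mu>
    by (rule ordIso_ordLeq_trans[OF ordIso_symmetric[OF card_of_Field_ordIso[OF assms[OF that]]]
          card_of_mono1[OF subset_UNIV]])
  then have "\<forall>\<mu>\<in>K. \<mu> \<le>o |UNIV :: 'k set|" by blast
  note * = least_cardinal[where P = "\<lambda>\<kappa>. \<forall>\<mu>\<in>K. \<mu> \<le>o \<kappa>", OF card_of_Card_order this,
      folded cardinal_Sup_def]
  show "Card_order (cardinal_Sup K)" "\<And>\<mu>. \<mu> \<in> K \<Longrightarrow> \<mu> \<le>o cardinal_Sup K"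
    using *(1,2) by simp_all
  show "cardinal_Sup K \<le>o \<kappa>" if "Card_order \<kappa>" "\<And>\<mu>. \<mu> \<in> K \<Longrightarrow> \<mu> \<le>o \<kappa>" for \<kappa> :: "'k rel"
    using that by (intro *(3)) simp_all
qed

lemma pi_character_at:
  assumes "x \<in> topspace X"
  shows "Card_order (pi_character_at X x)" and "cinfinite (pi_character_at X x)"
    and "\<exists>\<B>. local_pi_base X x \<B> \<and> |\<B>| \<le>o pi_character_at X x"
proof -
  have "local_pi_base X x {U. openin X U \<and> U \<noteq> {}}"
    unfolding local_pi_base_def open_family_def by blast
  then have "cinfinite |UNIV :: ('a set + nat) set| \<and>
      (\<exists>\<B>. local_pi_base X x \<B> \<and> |\<B>| \<le>o |UNIV :: ('a set + nat) set| )"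
    using cinfinite_UNIV family_le_UNIV by auto
  note * = least_cardinal[where P = "\<lambda>\<kappa>. cinfinite \<kappa> \<and> (\<exists>\<B>. local_pi_base X x \<B> \<and> |\<B>| \<le>o \<kappa>)",
      OF card_of_Card_order this, folded pi_character_at_def]
  show "Card_order (pi_character_at X x)" "cinfinite (pi_character_at X x)"
    "\<exists>\<B>. local_pi_base X x \<B> \<and> |\<B>| \<le>o pi_character_at X x"
    using * by simp_all
qed

lemma cellularity:
  shows "Card_order (cellularity X)" and "cinfinite (cellularity X)"
    and "\<And>\<U>. cellular_family X \<U> \<Longrightarrow> |\<U>| \<le>o cellularity X"
proof -
  have "cinfinite |UNIV :: ('a set + nat) set| \<and>
      (\<forall>\<U>. cellular_family X \<U> \<longrightarrow> |\<U>| \<le>o |UNIV :: ('a set + nat) set| )"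
    using cinfinite_UNIV family_le_UNIV by auto
  note * = least_cardinal[where P = "\<lambda>\<kappa>. cinfinite \<kappa> \<and> (\<forall>\<U>. cellular_family X \<U> \<longrightarrow> |\<U>| \<le>o \<kappa>)",
      OF card_of_Card_order this, folded cellularity_def]
  show "Card_order (cellularity X)" "cinfinite (cellularity X)"
    "\<And>\<U>. cellular_family X \<U> \<Longrightarrow> |\<U>| \<le>o cellularity X"
    using * by simp_all
qed

lemma q_pseudo_base_exists:
  assumes "Hausdorff_space X" "x \<in> topspace X"
  shows "q_pseudo_base X x {U. openin X U \<and> U \<noteq> {}}"
  unfolding q_pseudo_base_def open_family_def
proof (intro conjI ballI impI)
  fix y assume "y \<in> topspace X" "y \<noteq> x"
  then obtain U V where UV: "openin X U" "openin X V" "x \<in> U" "y \<in> V" "disjnt U V"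
    using assms unfolding Hausdorff_space_def by metis
  then have "x \<in> X closure_of U" "y \<notin> X closure_of U"
    using assms(2) by (auto simp: in_closure_of disjnt_iff)
  then show "\<exists>\<C>\<subseteq>{U. openin X U \<and> U \<noteq> {}}. x \<in> X closure_of \<Union>\<C> \<and> y \<notin> X closure_of \<Union>\<C>"
    using UV by (intro exI[of _ "{U}"]) auto
qed auto

lemma q_pseudo_character_at:
  assumes "Hausdorff_space X" "x \<in> topspace X"
  shows "Card_order (q_pseudo_character_at X x)"
    and "\<exists>\<B>. q_pseudo_base X x \<B> \<and> |\<B>| =o q_pseudo_character_at X x"
    and "\<And>\<B>. q_pseudo_base X x \<B> \<Longrightarrow> q_pseudo_character_at X x \<le>o |\<B>|"
proof -
  have iso: "|\<B>| =o |Inl ` \<B> :: ('a set + nat) set|" for \<B> :: "'a set set"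
    by (rule card_of_ordIsoI[of Inl]) (auto simp: bij_betw_def)
  let ?P = "\<lambda>\<kappa> :: 'a cardinal. \<exists>\<B>. q_pseudo_base X x \<B> \<and> |\<B>| =o \<kappa>"
  have P: "?P |Inl ` \<B>|" if "q_pseudo_base X x \<B>" for \<B>
    using that iso by blast
  note * = least_cardinal[where P = ?P, OF card_of_Card_order P[OF q_pseudo_base_exists[OF assms]],
      folded q_pseudo_character_at_def]
  show "Card_order (q_pseudo_character_at X x)"
    "\<exists>\<B>. q_pseudo_base X x \<B> \<and> |\<B>| =o q_pseudo_character_at X x"
    using * by simp_all
  show "q_pseudo_character_at X x \<le>o |\<B>|" if "q_pseudo_base X x \<B>" for \<B>
    by (rule ordLeq_ordIso_trans[OF *(3)[OF card_of_Card_order P[OF that]] ordIso_symmetric[OF iso]])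
qed

end

theory Submission
  imports Defs
begin

text \<open>
  Fix a point \<open>p\<close>, a \<open>q\<close>-pseudo base \<open>\<B>\<close> at \<open>p\<close>, and for each \<open>x\<close> a homeomorphism
  \<open>h x\<close> taking \<open>p\<close> to \<open>x\<close>.  The set of subfamilies of \<open>\<B>\<close> with \<open>p\<close> in the closure of
  their union does not depend on \<open>x\<close>, and transporting these subfamilies along \<open>h x\<close>
  isolates \<open>x\<close>.  So \<open>x\<close> is determined by the function sending \<open>b \<in> \<B>\<close> to the closure of
  \<open>h x ` b\<close>, and it remains to count the closures of open sets.

  A maximal disjoint refinement shows that the union of every open family has the same closure
  as the union of at most \<open>c(X)\<close> of its members.  Following Sapirovskii, close off a family of
  members of local \<open>\<pi>\<close>-bases: whenever at most \<open>c(X)\<close> members have a non-dense union, add a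
  local \<open>\<pi>\<close>-base at a point outside the closure of that union.  Regularity makes the result a
  \<open>\<pi>\<close>-base of the whole space, of size at most \<open>\<pi>\<chi>(X) ^ c(X)\<close>; hence there are at most
  that many closures of open sets.
\<close>

section \<open>Cardinal arithmetic: small subsets and closing off\<close>

lemma card_of_bounded_subsets:
  assumes \<kappa>: "Cinfinite \<kappa>" and \<mu>: "Cinfinite \<mu>" and exp: "\<mu> ^c \<kappa> \<le>o \<mu>" and A: "|A| \<le>o \<mu>"
  shows "|{C. C \<subseteq> A \<and> |C| \<le>o \<kappa>}| \<le>o \<mu>"
proof -
  let ?F = "Func (Field \<kappa>) A"
  \<comment> \<open>A nonempty subset of size at most \<kappa> is the range of a function on
    \<open>Field \<kappa>\<close>, so \<open>\<mu> ^c \<kappa>\<close> bounds their number. The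
    empty set is no such range and is added by hand.\<close>
  have "{C. C \<subseteq> A \<and> |C| \<le>o \<kappa>} \<subseteq> {{}} \<union> (\<lambda>f. f ` Field \<kappa>) ` ?F"
  proof
    fix C assume "C \<in> {C. C \<subseteq> A \<and> |C| \<le>o \<kappa>}"
    then have C: "C \<subseteq> A" "|C| \<le>o \<kappa>" by auto
    show "C \<in> {{}} \<union> (\<lambda>f. f ` Field \<kappa>) ` ?F"
    proof (cases "C = {}")
      case False
      have "|C| \<le>o |Field \<kappa>|"
        using C(2) \<kappa> card_of_Field_ordIso ordIso_symmetric ordLeq_ordIso_trans by blast
      then obtain g where g: "g ` Field \<kappa> = C"
        using False card_of_ordLeq2 by metis
      then have "(\<lambda>i. if i \<in> Field \<kappa> then g i else undefined) \<in> ?F"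
        using C(1) by (auto simp: Func_def)
      moreover have "C = (\<lambda>i. if i \<in> Field \<kappa> then g i else undefined) ` Field \<kappa>"
        using g by auto
      ultimately show ?thesis by blast
    qed simp
  qed
  then have "|{C. C \<subseteq> A \<and> |C| \<le>o \<kappa>}| \<le>o |{{}} \<union> (\<lambda>f. f ` Field \<kappa>) ` ?F|"
    by (rule card_of_mono1)
  moreover have "|{{}} \<union> (\<lambda>f. f ` Field \<kappa>) ` ?F| \<le>o \<mu>"
  proof (rule Un_Cinfinite_bound[OF _ _ \<mu>])
    show "|{{}}| \<le>o \<mu>"
      using \<mu> by (intro Card_order_singl_ordLeq) (auto simp: cinfinite_def)
    have "|?F| =o |A| ^c \<kappa>"
      unfolding cexp_def Field_card_of by (rule card_of_refl)
    also have "|A| ^c \<kappa> \<le>o \<mu> ^c \<kappa>"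
      using A \<kappa> by (intro cexp_mono1) auto
    also note exp
    finally show "|(\<lambda>f. f ` Field \<kappa>) ` ?F| \<le>o \<mu>"
      by (rule ordLeq_transitive[OF card_of_image])
  qed
  ultimately show ?thesis by (rule ordLeq_transitive)
qed

text \<open>Iterate along the successor cardinal of \<kappa>. By its regularity, a subset of size at
  most \<kappa> of the increasing union already lies in one stage, so its image under
  \<open>G\<close> enters at a later stage.\<close>

lemma closing_off:
  fixes \<kappa> :: "'a rel" and G :: "'b set \<Rightarrow> 'b set"
  assumes \<kappa>: "Cinfinite \<kappa>" and \<mu>: "Cinfinite \<mu>" and exp: "\<mu> ^c \<kappa> \<le>o \<mu>"
    and G: "\<And>C. |G C| \<le>o \<mu>"
  obtains V where "|V| \<le>o \<mu>" "\<And>C. C \<subseteq> V \<Longrightarrow> |C| \<le>o \<kappa> \<Longrightarrow> G C \<subseteq> V"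
proof -
  define r where "r = cardSuc \<kappa>"
  have r: "Cinfinite r" unfolding r_def using \<kappa> by (rule Cinfinite_cardSuc)
  then have wo: "wo_rel r" by (simp add: wo_rel_def card_order_on_def)
  \<comment> \<open>Stage \<open>i\<close> holds only the sets \<open>G C\<close> for small
    \<open>C\<close> below it. The stages still increase, because a later index has more such
    \<open>C\<close>.\<close>
  define H where "H F i = (\<Union>C \<in> {C. C \<subseteq> \<Union>(F ` underS r i) \<and> |C| \<le>o \<kappa>}. G C)" for F i
  define S where "S = wo_rel.worec r H"
  have "wo_rel.adm_wo r H"
    unfolding wo_rel.adm_wo_def[OF wo]
  proof (intro allI impI)
    fix F F' :: "'a set \<Rightarrow> 'b set" and i
    assume "\<forall>j\<in>underS r i. F j = F' j"
    then have "F ` underS r i = F' ` underS r i" by (intro image_cong) auto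
    then show "H F i = H F' i" by (simp add: H_def)
  qed
  then have "S = H S"
    unfolding S_def by (rule wo_rel.worec_fixpoint[OF wo])
  then have S: "S i = (\<Union>C \<in> {C. C \<subseteq> \<Union>(S ` underS r i) \<and> |C| \<le>o \<kappa>}. G C)" for i
    using H_def by metis
  have chain: "relChain r S"
    unfolding relChain_def
  proof (intro allI impI)
    fix i j assume "(i, j) \<in> r"
    then have "underS r i \<subseteq> underS r j"
      by (intro underS_incr wo_rel.TRANS[OF wo] wo_rel.ANTISYM[OF wo])
    then show "S i \<subseteq> S j"
      unfolding S[of i] S[of j] by (intro UN_mono) blast+
  qed
  \<comment> \<open>The length of the recursion is at most \<mu>, as \<kappa> lies strictly below
    \<open>ctwo ^c \<kappa>\<close>, which is at most \<open>\<mu> ^c \<kappa>\<close> and hence at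
    most \<mu>.\<close>
  have "\<kappa> <o ctwo ^c \<kappa>" using \<kappa> by (intro ordLess_ctwo_cexp) auto
  also have "ctwo ^c \<kappa> \<le>o \<mu> ^c \<kappa>"
    using \<kappa> \<mu> by (intro cexp_mono1 ctwo_ordLeq_Cinfinite) auto
  also note exp
  finally have r_le: "r \<le>o \<mu>"
    unfolding r_def using \<kappa> \<mu> by (intro cardSuc_least) auto
  have field_le: "|Field r| \<le>o \<mu>"
    using r r_le card_of_Field_ordIso ordIso_ordLeq_trans by blast
  have inf: "\<not> finite (Field \<mu>)" using \<mu> by (simp add: cinfinite_def)
  have bound: "|S i| \<le>o \<mu>" for i
  proof (induction rule: wo_rel.well_order_induct[OF wo])
    case (1 i)
    have "underS r i \<subseteq> Field r" by (auto simp: underS_def Field_def)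
    then have "|underS r i| \<le>o \<mu>"
      using field_le by (rule ordLeq_transitive[OF card_of_mono1])
    moreover have "\<forall>j\<in>underS r i. |S j| \<le>o \<mu>" using 1 by (auto simp: underS_def)
    ultimately have "|\<Union>(S ` underS r i)| \<le>o \<mu>"
      using \<mu> by (intro card_of_UNION_ordLeq_infinite_Field inf) auto
    from card_of_bounded_subsets[OF \<kappa> \<mu> exp this] show ?case
      unfolding S[of i] using \<mu> G by (intro card_of_UNION_ordLeq_infinite_Field inf) auto
  qed
  show thesis
  proof
    show "|\<Union>(S ` Field r)| \<le>o \<mu>"
      using \<mu> field_le bound by (intro card_of_UNION_ordLeq_infinite_Field inf) auto
    fix C assume C: "C \<subseteq> \<Union>(S ` Field r)" "|C| \<le>o \<kappa>"
    then obtain i where i: "i \<in> Field r" "C \<subseteq> S i"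
      using cardSuc_UNION_Cinfinite[OF \<kappa> chain[unfolded r_def]] unfolding r_def by blast
    \<comment> \<open>A strictly later stage is taken since \<open>S j\<close> looks only at sets
      below \<open>j\<close>. It exists because an infinite cardinal has no last element.\<close>
    obtain j where j: "j \<in> Field r" "i \<noteq> j" "(i, j) \<in> r"
      using infinite_Card_order_limit[OF _ _ i(1)] r by (auto simp: cinfinite_def)
    then have "C \<subseteq> \<Union>(S ` underS r j)" using i(2) by (auto simp: underS_def)
    then have "G C \<subseteq> S j" using C(2) unfolding S[of j] by blast
    then show "G C \<subseteq> \<Union>(S ` Field r)" using j(1) by blast
  qed
qed

section \<open>Cellularity, \<pi>-bases and the number of regular closed sets\<close>

lemma dense_subfamily:
  assumes W: "open_family X W"
  obtains C where "C \<subseteq> W" "|C| \<le>o cellularity X" "X closure_of \<Union>C = X closure_of \<Union>W"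
proof -
  \<comment> \<open>Zorn's lemma yields a maximal disjoint refinement \<open>M\<close> of
    \<open>W\<close>. Choosing for each member of \<open>M\<close> a member of \<open>W\<close>
    around it gives the subfamily.\<close>
  define \<A> where "\<A> = {\<G>. cellular_family X \<G> \<and> (\<forall>G\<in>\<G>. \<exists>V\<in>W. G \<subseteq> V)}"
  have "\<exists>M\<in>\<A>. \<forall>\<G>\<in>\<A>. M \<subseteq> \<G> \<longrightarrow> \<G> = M"
  proof (rule subset_Zorn')
    fix \<C> assume ch: "subset.chain \<A> \<C>"
    then have "\<C> \<subseteq> \<A>" by (simp add: subset.chain_def)
    moreover have "pairwise disjnt (\<Union>\<C>)"
      unfolding pairwise_def
    proof (intro ballI impI)
      fix A B assume "A \<in> \<Union>\<C>" "B \<in> \<Union>\<C>" "A \<noteq> B"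
      then obtain K where "K \<in> \<C>" "A \<in> K" "B \<in> K"
        using ch by (smt (verit) UnionE subset_chain_def subsetD)
      then show "disjnt A B"
        using \<open>\<C> \<subseteq> \<A>\<close> \<open>A \<noteq> B\<close> unfolding \<A>_def cellular_family_def pairwise_def by blast
    qed
    ultimately show "\<Union>\<C> \<in> \<A>"
      unfolding \<A>_def cellular_family_def open_family_def by blast
  qed
  then obtain M where M: "M \<in> \<A>" and max: "\<And>\<G>. \<G> \<in> \<A> \<Longrightarrow> M \<subseteq> \<G> \<Longrightarrow> \<G> = M" by blast
  from M have cell: "cellular_family X M" and "\<forall>G\<in>M. \<exists>V\<in>W. G \<subseteq> V" by (auto simp: \<A>_def)
  then obtain v where v: "\<And>G. G \<in> M \<Longrightarrow> v G \<in> W \<and> G \<subseteq> v G" by metis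
  show thesis
  proof
    show "v ` M \<subseteq> W" using v by blast
    show "|v ` M| \<le>o cellularity X"
      by (rule ordLeq_transitive[OF card_of_image cellularity(3)[OF cell]])
    have "\<Union>W \<subseteq> X closure_of \<Union>(v ` M)"
    proof
      fix x assume "x \<in> \<Union>W"
      then obtain V where V: "V \<in> W" "x \<in> V" by blast
      then have openV: "openin X V" using W by (auto simp: open_family_def)
      show "x \<in> X closure_of \<Union>(v ` M)"
        unfolding in_closure_of
      proof (intro conjI allI impI)
        show "x \<in> topspace X" using openV V(2) openin_subset by blast
        fix T assume T: "x \<in> T \<and> openin X T"
        show "\<exists>y. y \<in> \<Union>(v ` M) \<and> y \<in> T"
        proof (rule ccontr)
          assume none: "\<nexists>y. y \<in> \<Union>(v ` M) \<and> y \<in> T"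
          \<comment> \<open>This set could be added to \<open>M\<close>; maximality puts it into
            \<open>M\<close>, so it would be disjoint from itself although it contains
            \<open>x\<close>.\<close>
          define N where "N = T \<inter> V"
          have N: "openin X N" "x \<in> N" "N \<subseteq> V" using T V(2) openV by (auto simp: N_def)
          have disj: "disjnt N G" if "G \<in> M" for G
            using none v[OF that] that by (auto simp: N_def disjnt_iff)
          have "insert N M \<in> \<A>"
            using M N V(1) disj unfolding \<A>_def cellular_family_def open_family_def
            by (auto simp: pairwise_insert disjnt_sym)
          then have "N \<in> M" using max[of "insert N M"] by blast
          then show False using disj N(2) by (auto simp: disjnt_iff)
        qed
      qed
    qed
    then have "X closure_of \<Union>W \<subseteq> X closure_of \<Union>(v ` M)"
      by (simp add: closure_of_minimal)
    moreover have "\<Union>(v ` M) \<subseteq> \<Union>W" using v by blast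
    ultimately show "X closure_of \<Union>(v ` M) = X closure_of \<Union>W"
      by (meson closure_of_mono subset_antisym)
  qed
qed

lemma pi_character:
  assumes "topspace X \<noteq> {}"
  shows "Cinfinite (pi_character X)"
    and "\<And>x. x \<in> topspace X \<Longrightarrow> \<exists>\<B>. local_pi_base X x \<B> \<and> |\<B>| \<le>o pi_character X"
proof -
  have Sup: "Card_order (pi_character X)"
    unfolding pi_character_def by (rule cardinal_Sup(1)) (auto intro: pi_character_at(1))
  have le: "pi_character_at X x \<le>o pi_character X" if "x \<in> topspace X" for x
    unfolding pi_character_def
    by (rule cardinal_Sup(2)[OF _ imageI[OF that]]) (auto intro: pi_character_at(1))
  show "\<exists>\<B>. local_pi_base X x \<B> \<and> |\<B>| \<le>o pi_character X" if x: "x \<in> topspace X" for x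
  proof -
    obtain \<B> where "local_pi_base X x \<B>" "|\<B>| \<le>o pi_character_at X x"
      using pi_character_at(3)[OF x] by auto
    then show ?thesis using ordLeq_transitive[OF _ le[OF x]] by auto
  qed
  obtain x where x: "x \<in> topspace X" using assms by blast
  show "Cinfinite (pi_character X)"
    using cinfinite_mono[OF le[OF x] pi_character_at(2)[OF x]] Sup by simp
qed

lemma Cinfinite_pi_character_cexp:
  assumes "topspace X \<noteq> {}"
  shows "Cinfinite (pi_character X ^c cellularity X)"
  using pi_character(1)[OF assms] cellularity(1,2)
  by (intro Cinfinite_cexp ctwo_ordLeq_Cinfinite) auto

lemma pi_base_le:
  assumes reg: "regular_space X" and ne: "topspace X \<noteq> {}"
  obtains \<V> where "open_family X \<V>" "|\<V>| \<le>o pi_character X ^c cellularity X"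
    "\<And>U. openin X U \<Longrightarrow> U \<noteq> {} \<Longrightarrow> \<exists>V\<in>\<V>. V \<subseteq> U"
proof -
  define \<kappa> where "\<kappa> = cellularity X"
  define \<tau> where "\<tau> = pi_character X"
  define \<mu> where "\<mu> = \<tau> ^c \<kappa>"
  have \<kappa>: "Cinfinite \<kappa>" using cellularity by (auto simp: \<kappa>_def)
  have \<tau>: "Cinfinite \<tau>" using pi_character(1)[OF ne] by (simp add: \<tau>_def)
  have \<mu>: "Cinfinite \<mu>" using Cinfinite_pi_character_cexp[OF ne] by (simp add: \<mu>_def \<tau>_def \<kappa>_def)
  \<comment> \<open>The exponents multiply, and \<kappa> times \<kappa> is \<kappa>.\<close>
  have "\<mu> ^c \<kappa> =o \<mu>"
    unfolding \<mu>_def using \<tau> \<kappa> by (intro cexp_cprod_ordLeq Cinfinite_Cnotzero ordLeq_refl) auto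
  then have exp: "\<mu> ^c \<kappa> \<le>o \<mu>" by (rule ordIso_imp_ordLeq)
  have "\<tau> \<le>o \<mu>"
    unfolding \<mu>_def using \<tau> \<kappa> by (intro ordLeq_cexp1 Cinfinite_Cnotzero) auto
  then have "\<forall>p\<in>topspace X. \<exists>\<B>. local_pi_base X p \<B> \<and> |\<B>| \<le>o \<mu>"
    using pi_character(2)[OF ne] ordLeq_transitive unfolding \<tau>_def by blast
  then obtain B where B: "\<And>p. p \<in> topspace X \<Longrightarrow> local_pi_base X p (B p) \<and> |B p| \<le>o \<mu>"
    by metis
  \<comment> \<open>\<open>f C\<close> witnesses that the union of \<open>C\<close> is not dense; if
    it is dense, \<open>f C\<close> is an arbitrary point.\<close>
  have "\<forall>C. \<exists>p. p \<in> topspace X \<and> (\<not> topspace X \<subseteq> X closure_of \<Union>C \<longrightarrow> p \<notin> X closure_of \<Union>C)"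
    using ne by blast
  then obtain f where f: "\<And>C. f C \<in> topspace X"
    "\<And>C. \<not> topspace X \<subseteq> X closure_of \<Union>C \<Longrightarrow> f C \<notin> X closure_of \<Union>C"
    by metis
  obtain V where V: "|V| \<le>o \<mu>" "\<And>C. C \<subseteq> V \<Longrightarrow> |C| \<le>o \<kappa> \<Longrightarrow> B (f C) \<subseteq> V"
    using closing_off[OF \<kappa> \<mu> exp, of "\<lambda>C. B (f C)"] B f(1) by blast
  \<comment> \<open>\<open>closing_off\<close> may return sets that are not open. Discarding these
    keeps every \<open>B (f C)\<close> with small \<open>C\<close>, whose members are open and
    nonempty.\<close>
  define \<V> where "\<V> = {U \<in> V. openin X U \<and> U \<noteq> {}}"
  define L where "L = f ` {C. C \<subseteq> \<V> \<and> |C| \<le>o \<kappa>}"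
  have L: "L \<subseteq> topspace X" using f(1) by (auto simp: L_def)
  have BL: "B q \<subseteq> \<V>" if "q \<in> L" for q
  proof -
    from that[unfolded L_def] obtain C where q: "q = f C" and "C \<in> {C. C \<subseteq> \<V> \<and> |C| \<le>o \<kappa>}"
      by (rule imageE)
    then have C: "C \<subseteq> \<V>" "|C| \<le>o \<kappa>" by simp_all
    then have "B q \<subseteq> V" using V(2)[of C] q by (auto simp: \<V>_def)
    moreover have "open_family X (B q)" using B f(1) q by (simp add: local_pi_base_def)
    ultimately show ?thesis by (auto simp: \<V>_def open_family_def)
  qed
  have opn: "open_family X \<V>" by (auto simp: \<V>_def open_family_def)
  have dense: "topspace X \<subseteq> X closure_of L"
  proof
    fix a assume a: "a \<in> topspace X"
    show "a \<in> X closure_of L"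
    proof (rule ccontr)
      assume "a \<notin> X closure_of L"
      then obtain U where U: "openin X U" "a \<in> U" "disjnt (X closure_of L) (X closure_of U)"
        using reg a unfolding regular_space by (metis Diff_iff closedin_closure_of)
      \<comment> \<open>Near each \<open>q \<in> L\<close>, some member of \<open>B q\<close> avoids
        the closure of \<open>U\<close> and so belongs to \<open>W\<close>. Thus the closure of the
        union of \<open>W\<close> contains \<open>L\<close> but misses \<open>a\<close>. A small
        \<open>C\<close> with the same closure puts \<open>f C\<close> both in \<open>L\<close> and
        outside that closure.\<close>
      define W where "W = {V \<in> \<V>. disjnt V U}"
      have "open_family X W" using opn by (auto simp: W_def open_family_def)
      then obtain C where C: "C \<subseteq> W" "|C| \<le>o \<kappa>" "X closure_of \<Union>C = X closure_of \<Union>W"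
        using dense_subfamily \<kappa>_def by metis
      have "q \<in> X closure_of \<Union>W" if q: "q \<in> L" for q
        unfolding in_closure_of
      proof (intro conjI allI impI)
        show "q \<in> topspace X" using q L by blast
        fix T assume T: "q \<in> T \<and> openin X T"
        have "q \<notin> X closure_of U"
          using closure_of_subset[OF L] q U(3) by (auto simp: disjnt_iff)
        moreover have "openin X (T - X closure_of U)" using T by (simp add: openin_diff)
        ultimately obtain V where "V \<in> B q" "V \<subseteq> T - X closure_of U"
          using T B[of q] q L unfolding local_pi_base_def by blast
        moreover have "U \<subseteq> X closure_of U" using U(1) by (simp add: closure_of_subset openin_subset)
        ultimately have "V \<in> W" "V \<subseteq> T" "V \<noteq> {}"
          using BL[OF q] opn by (auto simp: W_def disjnt_iff open_family_def)
        then show "\<exists>y. y \<in> \<Union>W \<and> y \<in> T" by blast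
      qed
      then have LC: "L \<subseteq> X closure_of \<Union>C" using C(3) by blast
      have "a \<notin> X closure_of \<Union>C"
        using C(1) U(1,2) by (auto simp: in_closure_of W_def disjnt_iff)
      then have "f C \<notin> X closure_of \<Union>C" using f(2) a by blast
      moreover have "f C \<in> L" using C(1,2) by (auto simp: L_def W_def)
      ultimately show False using LC by blast
    qed
  qed
  show thesis
  proof
    show "open_family X \<V>" by (rule opn)
    have "\<V> \<subseteq> V" by (auto simp: \<V>_def)
    then show "|\<V>| \<le>o pi_character X ^c cellularity X"
      using V(1) unfolding \<mu>_def \<tau>_def \<kappa>_def by (rule ordLeq_transitive[OF card_of_mono1])
    fix U assume U: "openin X U" "U \<noteq> {}"
    then obtain a where "a \<in> U" "a \<in> X closure_of L"
      using dense openin_subset by blast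
    then obtain q where "q \<in> L" "q \<in> U" using U(1) by (auto simp: in_closure_of)
    then show "\<exists>V\<in>\<V>. V \<subseteq> U"
      using B[of q] BL L U(1) unfolding local_pi_base_def by blast
  qed
qed

text \<open>An open set has the same closure as the union of the \<pi>-base members inside it, and
  \<open>dense_subfamily\<close> thins these to a small family, which then codes the
  closure.\<close>

lemma card_of_regular_closed_le:
  assumes reg: "regular_space X" and ne: "topspace X \<noteq> {}"
  shows "|{X closure_of U | U. openin X U}| \<le>o pi_character X ^c cellularity X"
proof -
  obtain \<V> where V: "open_family X \<V>" "|\<V>| \<le>o pi_character X ^c cellularity X"
    "\<And>U. openin X U \<Longrightarrow> U \<noteq> {} \<Longrightarrow> \<exists>V\<in>\<V>. V \<subseteq> U"
    using pi_base_le[OF reg ne] by metis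
  let ?S = "{C. C \<subseteq> \<V> \<and> |C| \<le>o cellularity X}"
  have "{X closure_of U | U. openin X U} \<subseteq> (\<lambda>C. X closure_of \<Union>C) ` ?S"
  proof clarify
    fix U assume U: "openin X U"
    define W where "W = {V \<in> \<V>. V \<subseteq> U}"
    have oW: "open_family X W" using V(1) by (auto simp: W_def open_family_def)
    obtain C where C: "C \<subseteq> W" "|C| \<le>o cellularity X" "X closure_of \<Union>C = X closure_of \<Union>W"
      using dense_subfamily[OF oW] .
    have "U \<subseteq> X closure_of \<Union>W"
    proof
      fix x assume x: "x \<in> U"
      show "x \<in> X closure_of \<Union>W"
        unfolding in_closure_of
      proof (intro conjI allI impI)
        show "x \<in> topspace X" using x U openin_subset by blast
        fix T assume T: "x \<in> T \<and> openin X T"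
        then obtain V where "V \<in> \<V>" "V \<subseteq> T \<inter> U"
          using V(3)[of "T \<inter> U"] x U by (auto simp: openin_Int)
        moreover have "V \<noteq> {}" using \<open>V \<in> \<V>\<close> V(1) by (auto simp: open_family_def)
        ultimately show "\<exists>y. y \<in> \<Union>W \<and> y \<in> T" by (auto simp: W_def)
      qed
    qed
    then have "X closure_of U \<subseteq> X closure_of \<Union>W" by (simp add: closure_of_minimal)
    moreover have "X closure_of \<Union>W \<subseteq> X closure_of U"
      by (rule closure_of_mono) (auto simp: W_def)
    ultimately show "X closure_of U \<in> (\<lambda>C. X closure_of \<Union>C) ` ?S"
      using C by (auto simp: W_def)
  qed
  then have "|{X closure_of U | U. openin X U}| \<le>o |?S|"
    by (rule ordLeq_transitive[OF card_of_mono1 card_of_image])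
  also have "|?S| \<le>o pi_character X ^c cellularity X"
  proof (rule card_of_bounded_subsets[OF _ Cinfinite_pi_character_cexp[OF ne] _ V(2)])
    show "Cinfinite (cellularity X)" by (simp add: cellularity)
    then show "(pi_character X ^c cellularity X) ^c cellularity X \<le>o pi_character X ^c cellularity X"
      using pi_character(1)[OF ne]
      by (intro ordIso_imp_ordLeq cexp_cprod_ordLeq Cinfinite_Cnotzero ordLeq_refl) auto
  qed
  finally show ?thesis .
qed

section \<open>Coding points by functions on one q-pseudo base\<close>

theorem theorem4p2:
  fixes X :: "'a topology"
  assumes "regular_space X" and "Hausdorff_space X" and "homogeneous_space X"
  shows "|topspace X| \<le>o pi_character X ^c (cellularity X *c q_pseudo_character X)"
proof (cases "topspace X = {}")
  \<comment> \<open>Without points the supremum defining \<open>pi_character X\<close> is zero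
    rather than infinite, so this case stands apart.\<close>
  case True
  then show ?thesis by (simp add: Card_order_cexp card_of_empty1 Card_order_empty)
next
  case False
  then obtain p where p: "p \<in> topspace X" by blast
  define \<mu> where "\<mu> = pi_character X ^c cellularity X"
  have \<mu>: "Cinfinite \<mu>" using Cinfinite_pi_character_cexp[OF False] by (simp add: \<mu>_def)
  let ?q = "q_pseudo_character X"
  obtain \<B> where B: "q_pseudo_base X p \<B>" "|\<B>| =o q_pseudo_character_at X p"
    using q_pseudo_character_at(2)[OF assms(2) p] by blast
  have "q_pseudo_character_at X p \<le>o ?q"
    unfolding q_pseudo_character_def
    by (rule cardinal_Sup(2)[OF _ imageI[OF p]]) (auto intro: q_pseudo_character_at(1)[OF assms(2)])
  with B(2) have Bq: "|\<B>| \<le>o ?q" by (rule ordIso_ordLeq_trans)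
  have "\<forall>x\<in>topspace X. \<exists>h. homeomorphic_map X X h \<and> h p = x"
    using assms(3) p by (auto simp: homogeneous_space_def)
  then obtain h where h: "\<And>x. x \<in> topspace X \<Longrightarrow> homeomorphic_map X X (h x) \<and> h x p = x"
    by metis
  have openB: "openin X b" if "b \<in> \<B>" for b
    using B(1) that by (auto simp: q_pseudo_base_def open_family_def)
  let ?R = "{X closure_of U | U. openin X U}"
  \<comment> \<open>The value \<open>undefined\<close> off \<open>\<B>\<close> places
    \<open>\<Phi> x\<close> in \<open>Func \<B> ?R\<close>.\<close>
  define \<Phi> where "\<Phi> x b = (if b \<in> \<B> then X closure_of (h x ` b) else undefined)" for x b
  have "inj_on \<Phi> (topspace X)"
  proof (rule inj_onI, rule ccontr)
    fix x y assume x: "x \<in> topspace X" and y: "y \<in> topspace X"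
      and eq: "\<Phi> x = \<Phi> y" and "x \<noteq> y"
    have hx: "homeomorphic_map X X (h x)" and hy: "homeomorphic_map X X (h y)"
      using h x y by auto
    have "y \<in> h x ` topspace X"
      using homeomorphic_imp_surjective_map[OF hx] y by simp
    \<comment> \<open>Pulling \<open>y\<close> back along \<open>h x\<close> turns the separation of
      \<open>x\<close> from \<open>y\<close> into that of \<open>p\<close> from \<open>z\<close>,
      where the q-pseudo base at \<open>p\<close> applies.\<close>
    then obtain z where z: "z \<in> topspace X" "h x z = y" by (metis imageE)
    then have "z \<noteq> p" using h[OF x] \<open>x \<noteq> y\<close> by auto
    then obtain C where C: "C \<subseteq> \<B>" "p \<in> X closure_of \<Union>C" "z \<notin> X closure_of \<Union>C"
      using B(1) z(1) unfolding q_pseudo_base_def by blast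
    have sub: "\<Union>C \<subseteq> topspace X" using C(1) openB openin_subset by blast
    have "X closure_of (h x ` b) = X closure_of (h y ` b)" if "b \<in> C" for b
      using fun_cong[OF eq, of b] C(1) that by (auto simp: \<Phi>_def)
    moreover have "h y ` b \<subseteq> X closure_of (h y ` b)" if "b \<in> C" for b
      using that C(1) openB homeomorphic_imp_surjective_map[OF hy] openin_subset
      by (intro closure_of_subset) blast
    moreover have "X closure_of (h x ` b) \<subseteq> X closure_of (h x ` \<Union>C)" if "b \<in> C" for b
      using that by (intro closure_of_mono) blast
    \<comment> \<open>Equal codes let the closure of \<open>h x\<close>
      \<Union>C\<open>absorb that of\<close>h y \<open>\<Union>C\<close>, which contains
      \<open>y\<close>; yet \<open>z\<close> was separated from \<open>p\<close>.\<close>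
    ultimately have "h y ` \<Union>C \<subseteq> X closure_of (h x ` \<Union>C)" by fast
    then have "X closure_of (h y ` \<Union>C) \<subseteq> X closure_of (h x ` \<Union>C)"
      by (simp add: closure_of_minimal)
    moreover have "y \<in> X closure_of (h y ` \<Union>C)"
      using homeomorphic_map_closure_of[OF hy sub] C(2) h[OF y] by force
    ultimately have "h x z \<in> h x ` (X closure_of \<Union>C)"
      using homeomorphic_map_closure_of[OF hx sub] z(2) by blast
    then show False
      using C(3) z(1) homeomorphic_imp_injective_map[OF hx]
      by (metis closure_of_subset_topspace inj_on_image_mem_iff)
  qed
  moreover have "\<Phi> ` topspace X \<subseteq> Func \<B> ?R"
  proof clarify
    fix x assume "x \<in> topspace X"
    then have "openin X (h x ` b)" if "b \<in> \<B>" for b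
      using h homeomorphic_map_openness openB[OF that] openin_subset by blast
    then show "\<Phi> x \<in> Func \<B> ?R" by (auto simp: Func_def \<Phi>_def)
  qed
  ultimately have "|topspace X| \<le>o |?R| ^c |\<B>|"
    unfolding cexp_def Field_card_of card_of_ordLeq[symmetric] by blast
  also have "|?R| ^c |\<B>| \<le>o \<mu> ^c |\<B>|"
    unfolding \<mu>_def by (intro cexp_mono1 card_of_regular_closed_le assms False card_of_Card_order)
  also have "\<mu> ^c |\<B>| \<le>o \<mu> ^c ?q"
  proof (cases "\<B> = {}")
    \<comment> \<open>With empty exponent the power is 1, its only function being constantly
      \<open>undefined\<close>; it is compared directly with a nonempty cardinal.\<close>
    case True
    have ne: "Field (\<mu> ^c ?q) \<noteq> {}"
      using \<mu> by (auto simp: cexp_def Field_card_of Func_is_emp cinfinite_def)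
    have single: "\<mu> ^c |\<B>| = |{\<lambda>_. undefined}|"
      by (simp only: True cexp_def Field_card_of Func_empty)
    show ?thesis
      unfolding single by (rule Card_order_singl_ordLeq[OF Card_order_cexp ne])
  next
    case False
    then show ?thesis using \<mu> Bq by (intro cexp_mono2') (auto simp: Field_card_of)
  qed
  also have "\<mu> ^c ?q =o pi_character X ^c (cellularity X *c ?q)"
    unfolding \<mu>_def using pi_character(1)[OF False] by (intro cexp_cprod) auto
  finally show ?thesis .
qed

end
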